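(* Let $d\ge2$ and let $\gamma(t)$, $t\in[0,1]$, be a curve in $\mathbb{C}^d$ parametrized by rational functions with complex coefficients, which is not contained in any affine hyperplane of $\mathbb{C}^d$. If $P\subseteq\mathbb{R}^d$ is a polytopal region, then the Fourier--Laplace transform $\widehat{\mathbf 1_P}$ cannot vanish identically on $\gamma(t)$, $t\in[0,1]$. In particular, the conclusion holds if $\gamma([0,1])\subseteq\mathbb{R}^d$ and $\gamma([0,1])$ is not contained in any (real) affine hyperplane of $\mathbb{R}^d$.
   Context: A polytopal region in $\mathbb{R}^d$ is a (non-empty) finite union of bounded convex $d$-dimensional polytopes with pairwise disjoint interiors. For $x,y\in\mathbb{C}^d$, $x\cdot y=x_1y_1+\cdots+x_dy_d$ (no conjugation). The Fourier--Laplace transform of the indicator function of a bounded measurable set $P\subseteq\mathbb{R}^d$ is $\widehat{\mathbf 1_P}(z)=\int_P e^{-2\pi i z\cdot x}\,dx$, $z\in\mathbb{C}^d$. An affine hyperplane of $\mathbb{C}^d$ is a translate of a $(d-1)$-dimensional $\mathbb{C}$-linear subspace. *)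

theory Defs
  imports "HOL-Analysis.Analysis" "HOL-Computational_Algebra.Polynomial"
begin

definition polytopal_region :: "(real ^ 'n) set \<Rightarrow> bool" where
  "polytopal_region P \<longleftrightarrow>
     (\<exists>F. finite F \<and> F \<noteq> {} \<and>
          (\<forall>Q\<in>F. polytope Q \<and> aff_dim Q = int CARD('n)) \<and>
          pairwise (\<lambda>Q R. disjnt (interior Q) (interior R)) F \<and>
          P = \<Union>F)"

text \<open>The bilinear (not sesquilinear) product.\<close>

definition bilin :: "complex ^ 'n \<Rightarrow> complex ^ 'n \<Rightarrow> complex" where
  "bilin x y = (\<Sum>i\<in>UNIV. x $ i * y $ i)"

definition cvec :: "real ^ 'n \<Rightarrow> complex ^ 'n" where
  "cvec x = (\<chi> i. complex_of_real (x $ i))"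

definition fourier_laplace :: "(real ^ 'n) set \<Rightarrow> complex ^ 'n \<Rightarrow> complex" where
  "fourier_laplace P z =
     (LINT x:P|lebesgue. exp (- 2 * complex_of_real pi * \<i> * bilin z (cvec x)))"

text \<open>For scalars \<^typ>\<open>complex\<close> this is a complex affine hyperplane, for \<^typ>\<open>real\<close> a real one;
  \<^const>\<open>vec.subspace\<close> and \<^const>\<open>vec.dim\<close> are taken over the field of the components.\<close>

definition affine_hyperplane :: "('a :: field ^ 'n) set \<Rightarrow> bool" where
  "affine_hyperplane H \<longleftrightarrow>
     (\<exists>a V. vec.subspace V \<and> vec.dim V = CARD('n) - 1 \<and> H = (\<lambda>v. a + v) ` V)"

text \<open>A rational function that is defined on the whole of \<open>[0,1]\<close> has, in lowest terms, a denominator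
  without zeros there. Values of \<open>\<gamma>\<close> outside \<open>[0,1]\<close> are unconstrained.\<close>

definition rational_curve :: "(real \<Rightarrow> complex ^ 'n) \<Rightarrow> bool" where
  "rational_curve \<gamma> \<longleftrightarrow>
     (\<forall>i. \<exists>p q :: complex poly. \<forall>t\<in>{0..1}.
        poly q (complex_of_real t) \<noteq> 0 \<and>
        \<gamma> t $ i = poly p (complex_of_real t) / poly q (complex_of_real t))"

end

theory Submission
  imports Defs "HOL-Computational_Algebra.Fundamental_Theorem_Algebra"
begin

text \<open>Triangulating \<open>P\<close> gives, off finitely many real hyperplanes, Brion's formula: the transform
  is a sum of terms \<open>c\<^sub>v(z) exp(- 2 \<pi> i z \<cdot> v)\<close> over finitely many points \<open>v\<close>, where the \<open>c\<^sub>v\<close> are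
  rational and homogeneous of degree \<open>- d\<close>. On a rational curve lying in no hyperplane the exponents
  differ by nonconstant rational functions, so the exponentials are linearly independent over the
  rational functions. If the transform vanished on the curve, every \<open>c\<^sub>v\<close> would therefore vanish
  along it. By homogeneity the transform would then vanish on the whole complex line through a
  generic point of the curve, hence at the origin, where its value is the volume of \<open>P\<close>.\<close>

section \<open>Independence of exponentials of rational functions\<close>

text \<open>The transform itself is not homogeneous; only its coefficients are. Vanishing along the
  curve can therefore be carried off the curve only after the exponentials have been separated, and
  this is what the independence statement is for. The frequencies and the denominators are real
  vectors, so only hyperplanes with real normal vectors can cause trouble. Each linear form with a
  nonzero real normal is nonconstant along the curve. This makes differences of exponents
  nonconstant, and it also keeps the curve off the exceptional hyperplanes except at finitely many
  parameters. These hyperplanes pass through the origin, so nonzero multiples of a good point are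
  good. The origin is reached only as a limit, because Brion's formula breaks down there.\<close>

lemma pderiv_quotient_rule_common_factor:
  fixes a b h :: "'a :: idom poly"
  shows "pderiv (h * a) * (h * b) - (h * a) * pderiv (h * b) =
         h^2 * (pderiv a * b - a * pderiv b)"
  by (simp add: pderiv_mult algebra_simps power2_eq_square)

text \<open>Dividing the Wronskian by \<open>p * q\<close> gives the logarithmic derivative of
  \<open>p / q\<close>, whose pole at \<alpha> is at most simple. The extra factor \<open>x\<close>
  absorbs that pole and avoids exponents such as \<open>m - 1\<close>, which would go wrong at
  \<open>m = 0\<close>.\<close>

lemma linear_power_dvd_wronskian:
  fixes p q :: "complex poly" and \<alpha> :: complex
  defines "x \<equiv> [:- \<alpha>, 1:]"
  assumes "x ^ m dvd p" "x ^ n dvd q"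
  shows "x ^ (m + n) dvd x * (q * pderiv p - p * pderiv q)"
proof -
  have dx: "pderiv x = 1" by (simp add: x_def pderiv_pCons one_pCons)
  have *: "x ^ m dvd x * pderiv p" if xp: "x ^ m dvd p" for m p
  proof (cases m)
    case (Suc k)
    obtain r where r: "p = x ^ Suc k * r" using xp Suc by blast
    have "x * pderiv p = x ^ Suc k * (x * pderiv r + smult (of_nat (Suc k)) r)"
      unfolding r pderiv_mult pderiv_power_Suc
      by (simp add: dx algebra_simps)
    then show ?thesis using Suc by (metis dvd_triv_left)
  qed simp
  have "x * (q * pderiv p - p * pderiv q) = (x * pderiv p) * q - p * (x * pderiv q)"
    by (simp add: algebra_simps)
  then show ?thesis
    using *[OF assms(2)] *[OF assms(3)] assms(2,3) by (simp add: power_add mult_dvd_mono dvd_diff)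
qed

text \<open>The hypothesis says that the logarithmic derivative of \<open>p / q\<close> is the derivative of
  \<open>- a / b\<close>. The former has only simple poles and vanishes at infinity; the latter
  has no simple poles.\<close>

lemma log_deriv_eq_rational_deriv_imp_const:
  fixes a b p q :: "complex poly"
  assumes "p \<noteq> 0" "q \<noteq> 0" "b \<noteq> 0"
    and "b^2 * (q * pderiv p - p * pderiv q) + p * q * (pderiv a * b - a * pderiv b) = 0"
  shows "\<exists>c. a = smult c b"
  using assms(3,4)
proof (induction "degree b" arbitrary: a b)
  case 0
  then obtain c where b: "b = [:c:]" "c \<noteq> 0"
    by (metis degree_0_id degree_eq_zeroE pCons_eq_0_iff)
  have eq: "smult c (q * pderiv p - p * pderiv q) + p * q * pderiv a = 0"
  proof -
    have "[:c:] * (smult c (q * pderiv p - p * pderiv q) + p * q * pderiv a) = 0"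
      using 0(3) by (simp add: b power2_eq_square algebra_simps smult_add_right smult_diff_right)
    then show ?thesis using b(2) by (simp only: mult_eq_0_iff) simp
  qed
  have "pderiv a = 0"
  proof (rule ccontr)
    assume a: "pderiv a \<noteq> 0"
    \<comment> \<open>Behaviour at infinity: the Wronskian has degree below that of
      \<open>p * q\<close>, whereas \<open>p * q * pderiv a\<close> has at least that degree. The
      second disjunct covers constant \<open>p\<close>, where the degree does not drop but the
      derivative is zero.\<close>
    have d1: "degree (q * pderiv p) < degree p + degree q \<or> q * pderiv p = 0"
      using degree_mult_le[of q "pderiv p"] degree_pderiv[of p]
      by (cases "degree p = 0") (auto simp: pderiv_eq_0_iff)
    have d2: "degree (p * pderiv q) < degree p + degree q \<or> p * pderiv q = 0"
      using degree_mult_le[of p "pderiv q"] degree_pderiv[of q]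
      by (cases "degree q = 0") (auto simp: pderiv_eq_0_iff)
    have "smult c (q * pderiv p - p * pderiv q) = - (p * q * pderiv a)"
      using eq by (simp add: eq_neg_iff_add_eq_0)
    then have d3: "degree (q * pderiv p - p * pderiv q) = degree p + degree q + degree (pderiv a)"
      using b(2) a assms by (metis degree_minus degree_mult_eq degree_smult_eq mult_eq_0_iff)
    have "q * pderiv p - p * pderiv q \<noteq> 0"
      using eq a assms by auto
    then show False using d1 d2 d3 degree_diff_less[of "q * pderiv p" "degree p + degree q" "p * pderiv q"]
      by (auto split: if_splits)
  qed
  then obtain k where "a = [:k:]"
    by (metis degree_eq_zeroE pderiv_eq_0_iff)
  then have "a = smult (k / c) b" using b by simp
  then show ?case by blast
next
  case (Suc n)
  then obtain \<alpha> where \<alpha>: "poly b \<alpha> = 0"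
    by (metis constant_degree fundamental_theorem_of_algebra nat.distinct(1))
  define x where "x = [:- \<alpha>, 1:]"
  have x0: "x \<noteq> 0" and dx: "pderiv x = 1"
    by (simp_all add: x_def pderiv_pCons one_pCons)
  show ?case
  proof (cases "poly a \<alpha> = 0")
    case True
    obtain a1 b1 where ab: "a = x * a1" "b = x * b1"
      using True \<alpha> by (metis dvdE poly_eq_0_iff_dvd x_def)
    have b1: "b1 \<noteq> 0" using ab Suc by auto
    have "degree b1 = n" using Suc(2) degree_mult_eq[OF x0 b1] by (simp add: ab(2)) (simp add: x_def)
    \<comment> \<open>A common root of \<open>a\<close> and \<open>b\<close> is cancelled: the whole
      hypothesis scales by \<open>x^2\<close>, and the degree of the denominator drops.\<close>
    moreover have "x^2 * (b1^2 * (q * pderiv p - p * pderiv q) +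
        p * q * (pderiv a1 * b1 - a1 * pderiv b1)) = 0"
      using Suc(4) unfolding ab pderiv_quotient_rule_common_factor
      by (simp add: algebra_simps power_mult_distrib)
    ultimately obtain c where "a1 = smult c b1"
      using Suc(1)[of b1 a1] b1 x0 by auto
    then show ?thesis using ab by auto
  next
    case False
    define m where "m = order \<alpha> b"
    have m: "m > 0" using \<alpha> Suc(3) by (simp add: m_def order_root)
    define d where "d = pderiv a * b - a * pderiv b"
    obtain B where B: "b = x ^ m * B" "poly B \<alpha> \<noteq> 0"
      using order_decomp[OF Suc(3), of \<alpha>] unfolding m_def x_def
      by (auto simp: poly_eq_0_iff_dvd)
    \<comment> \<open>A genuine pole of \<open>a / b\<close> of order \<open>m\<close> becomes one
      of order \<open>m + 1\<close> in the derivative: the coefficient \<open>- m * a * B\<close>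
      does not vanish at \<alpha>, so \<open>d\<close> has order exactly
      \<open>m - 1\<close>.\<close>
    have xd: "x * d = x ^ m * (x * (pderiv a * B - a * pderiv B) - smult (of_nat m) (a * B))"
    proof -
      obtain k where k: "m = Suc k" using m gr0_conv_Suc by blast
      show ?thesis unfolding d_def B k pderiv_mult pderiv_power_Suc
        by (simp add: dx algebra_simps)
    qed
    define E where "E = x * (pderiv a * B - a * pderiv B) - smult (of_nat m) (a * B)"
    have E: "poly E \<alpha> \<noteq> 0"
      using False B m by (simp add: E_def x_def)
    have E0: "E \<noteq> 0" using E by auto
    \<comment> \<open>Orders at \<alpha> are compared in the hypothesis multiplied by
      \<open>x\<close>. The Wronskian side contributes at least \<open>2 * m\<close> beyond the
      orders of \<open>p\<close> and \<open>q\<close>, the other side exactly \<open>m\<close>,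
      which contradicts \<open>m > 0\<close>.\<close>
    have "x ^ (order \<alpha> p + order \<alpha> q) dvd x * (q * pderiv p - p * pderiv q)"
      unfolding x_def by (rule linear_power_dvd_wronskian) (auto simp: order_1)
    moreover have "x ^ (2 * m) dvd b^2"
      by (simp add: B power_mult_distrib flip: power_mult) (simp add: mult.commute)
    ultimately have "x ^ (2 * m + (order \<alpha> p + order \<alpha> q)) dvd b^2 * (x * (q * pderiv p - p * pderiv q))"
      by (simp add: power_add mult_dvd_mono)
    also have "b^2 * (x * (q * pderiv p - p * pderiv q)) = - (p * q * (x ^ m * E))"
      using Suc(4) unfolding E_def xd[symmetric] d_def by algebra
    finally have dv: "x ^ (2 * m + (order \<alpha> p + order \<alpha> q)) dvd p * q * (x ^ m * E)" by simp
    have ne: "p * q * (x ^ m * E) \<noteq> 0" using assms x0 E0 by simp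
    have "2 * m + (order \<alpha> p + order \<alpha> q) \<le> order \<alpha> (p * q * (x ^ m * E))"
      using dv order_divides[of \<alpha> _ "p * q * (x ^ m * E)"] ne by (simp add: x_def)
    also have "\<dots> = order \<alpha> p + order \<alpha> q + m"
      using ne E by (simp add: order_mult x_def order_power_n_n order_0I)
    finally show ?thesis using m by simp
  qed
qed

text \<open>Differentiating a relation and eliminating one exponential gives a shorter relation,
  whose coefficients vanish by induction. Each of these equations says that \<open>c v * e v\<close>
  and \<open>c w * e w\<close> have the same logarithmic derivative, which the preceding lemma
  excludes for nonzero \<open>c v\<close> and \<open>c w\<close>. The open interval provides
  two-sided derivatives.\<close>

lemma exp_rational_linear_independent:
  fixes A :: "'v \<Rightarrow> complex poly" and b :: "complex poly" and c :: "'v \<Rightarrow> complex poly"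
  assumes "finite V" and b: "\<And>t. t \<in> {0<..<1} \<Longrightarrow> poly b (of_real t) \<noteq> 0"
    and "\<And>v w k. v \<in> V \<Longrightarrow> w \<in> V \<Longrightarrow> v \<noteq> w \<Longrightarrow> A v - A w \<noteq> smult k b"
    and "\<And>t. t \<in> {0<..<1} \<Longrightarrow>
      (\<Sum>v\<in>V. poly (c v) (of_real t) * exp (poly (A v) (of_real t) / poly b (of_real t))) = 0"
  shows "\<forall>v\<in>V. c v = 0"
  using assms(1,3,4)
proof (induction arbitrary: c rule: finite_induct)
  case (insert w V)
  have b0: "b \<noteq> 0" using b[of "1/2"] by auto
  define e where "e v t = exp (poly (A v) (of_real t) / poly b (of_real t))" for v and t :: real
  \<comment> \<open>\<open>R v / b^2\<close> is the coefficient of \<open>e v\<close> in the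
    derivative of \<open>c v * e v\<close>.\<close>
  define R where "R v = b^2 * pderiv (c v) + c v * (pderiv (A v) * b - A v * pderiv b)" for v
  have rel: "(\<Sum>v\<in>insert w V. poly (c v) (of_real t) * e v t) = 0" if "t \<in> {0<..<1}" for t
    using insert.prems(2)[OF that] by (simp add: e_def)
  have deriv_term: "((\<lambda>t. poly (c v) (of_real t) * e v t) has_vector_derivative
      poly (R v) (of_real t) / poly b (of_real t)^2 * e v t) (at t)" if t: "t \<in> {0<..<1}" for v t
  proof -
    have "((\<lambda>z. poly (c v) z * exp (poly (A v) z / poly b z)) has_field_derivative
      poly (R v) (of_real t) / poly b (of_real t)^2 * e v t) (at (of_real t))"
      using b[OF t]
      by (auto intro!: derivative_eq_intros poly_DERIV simp: e_def R_def field_simps power2_eq_square)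
    from has_vector_derivative_real_field[OF this] show ?thesis
      by (simp add: e_def o_def)
  qed
  have relR: "(\<Sum>v\<in>insert w V. poly (R v) (of_real t) * e v t) = 0" if t: "t \<in> {0<..<1}" for t
  proof -
    have "((\<lambda>t. \<Sum>v\<in>insert w V. poly (c v) (of_real t) * e v t) has_vector_derivative
       (\<Sum>v\<in>insert w V. poly (R v) (of_real t) / poly b (of_real t)^2 * e v t)) (at t)"
      by (intro has_vector_derivative_sum deriv_term t)
    moreover have "((\<lambda>t. \<Sum>v\<in>insert w V. poly (c v) (of_real t) * e v t) has_vector_derivative 0) (at t)"
      by (rule has_vector_derivative_transform_within_open[of "\<lambda>_. 0" _ _ "{0<..<1}"])
        (use t rel in \<open>auto\<close>)
    ultimately have "0 = (\<Sum>v\<in>insert w V. poly (R v) (of_real t) / poly b (of_real t)^2 * e v t)"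
      by (rule vector_derivative_unique_at[symmetric])
    also have "\<dots> = (\<Sum>v\<in>insert w V. poly (R v) (of_real t) * e v t) / poly b (of_real t)^2"
      by (simp add: sum_divide_distrib)
    finally show ?thesis using b[OF t] by simp
  qed
  have distinct: "A v - A u \<noteq> smult k b" if "v \<in> V" "u \<in> V" "v \<noteq> u" for v u k
    using insert.prems(1) that by blast
  show ?case
  proof (cases "c w = 0")
    case True
    have "(\<Sum>v\<in>V. poly (c v) (of_real t) * exp (poly (A v) (of_real t) / poly b (of_real t))) = 0"
      if "t \<in> {0<..<1}" for t
      using rel[OF that] insert.hyps True by (simp add: e_def)
    then show ?thesis using insert.IH[OF distinct] True by blast
  next
    case False
    have "(\<Sum>v\<in>V. poly (c w * R v - c v * R w) (of_real t) *
        exp (poly (A v) (of_real t) / poly b (of_real t))) = 0" if t: "t \<in> {0<..<1}" for t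
    proof -
      have "(\<Sum>v\<in>V. poly (c w * R v - c v * R w) (of_real t) * e v t) =
        poly (c w) (of_real t) * (\<Sum>v\<in>insert w V. poly (R v) (of_real t) * e v t) -
        poly (R w) (of_real t) * (\<Sum>v\<in>insert w V. poly (c v) (of_real t) * e v t)"
        using insert.hyps by (simp add: sum_distrib_left sum_subtractf algebra_simps)
      then show ?thesis using rel[OF t] relR[OF t] by (simp add: e_def)
    qed
    then have W: "\<forall>v\<in>V. c w * R v - c v * R w = 0"
      using insert.IH[OF distinct, of "\<lambda>v. c w * R v - c v * R w"] by blast
    have V0: "c v = 0" if v: "v \<in> V" for v
    proof (rule ccontr)
      assume cv: "c v \<noteq> 0"
      \<comment> \<open>This is the hypothesis of the logarithmic derivative lemma for
        \<open>p = c v\<close>, \<open>q = c w\<close> and \<open>a = A v - A w\<close>.\<close>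
      have "b^2 * (c w * pderiv (c v) - c v * pderiv (c w)) +
          c v * c w * (pderiv (A v - A w) * b - (A v - A w) * pderiv b) = c w * R v - c v * R w"
        by (simp add: R_def pderiv_diff algebra_simps)
      then have "\<exists>k. A v - A w = smult k b"
        using W v by (intro log_deriv_eq_rational_deriv_imp_const[OF cv False b0]) simp
      then show False using insert.prems(1)[of v w] insert.hyps v by auto
    qed
    have "poly (c w) (of_real t) = 0" if "t \<in> {0<..<1}" for t
      using rel[OF that] insert.hyps V0 by (simp add: e_def)
    then have "complex_of_real ` {0<..<1} \<subseteq> {z. poly (c w) z = 0}" by auto
    moreover have "infinite (complex_of_real ` {0<..<1})"
      by (simp add: finite_image_iff inj_on_def infinite_Ioo)
    ultimately show ?thesis
      using False poly_roots_finite[of "c w"] finite_subset by blast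
  qed
qed simp

section \<open>Linear changes of variables\<close>

text \<open>Uniqueness of Haar measure, by the usual Fubini argument applied to
  \<open>(x, y) \<mapsto> \<phi> (x + y) \<psi> y\<close>.\<close>

lemma translation_invariant_eq_scaled_lborel:
  fixes \<mu> :: "'a::euclidean_space measure"
  assumes sets_mu: "sets \<mu> = sets borel" and "sigma_finite_measure \<mu>"
    and trans: "\<And>c. distr \<mu> borel ((+) c) = \<mu>" and refl: "distr \<mu> borel uminus = \<mu>"
    and X: "X \<in> sets borel"
  shows "emeasure \<mu> X = emeasure \<mu> (cbox 0 One) * emeasure lborel X"
proof -
  interpret \<mu>: sigma_finite_measure \<mu> by fact
  interpret pair_sigma_finite \<mu> lborel ..
  note [measurable_cong] = sets_mu
  note [measurable] = X
  define \<phi> :: "'a \<Rightarrow> ennreal" where "\<phi> = indicator X"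
  define \<psi> :: "'a \<Rightarrow> ennreal" where "\<psi> = indicator (cbox 0 One)"
  have [measurable]: "\<phi> \<in> borel_measurable borel" "\<psi> \<in> borel_measurable borel"
    by (auto simp: \<phi>_def \<psi>_def)
  have tr: "(\<integral>\<^sup>+x. f (c + x) \<partial>\<mu>) = (\<integral>\<^sup>+x. f x \<partial>\<mu>)" if [measurable]: "f \<in> borel_measurable borel"
    for f :: "'a \<Rightarrow> ennreal" and c
    by (subst (2) trans[of c, symmetric], subst nn_integral_distr) auto
  have rf: "(\<integral>\<^sup>+x. f (- x) \<partial>\<mu>) = (\<integral>\<^sup>+x. f x \<partial>\<mu>)" if [measurable]: "f \<in> borel_measurable borel"
    for f :: "'a \<Rightarrow> ennreal"
    by (subst (2) refl[symmetric], subst nn_integral_distr) auto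
  have trl: "(\<integral>\<^sup>+x. f (c + x) \<partial>lborel) = (\<integral>\<^sup>+x. f x \<partial>lborel)" if [measurable]: "f \<in> borel_measurable borel"
    for f :: "'a \<Rightarrow> ennreal" and c
    by (subst (2) lborel_distr_plus[of c, symmetric], subst nn_integral_distr) auto
  have "(\<integral>\<^sup>+x. \<phi> x \<partial>\<mu>) * (\<integral>\<^sup>+y. \<psi> y \<partial>lborel) = (\<integral>\<^sup>+y. (\<integral>\<^sup>+x. \<phi> x \<partial>\<mu>) * \<psi> y \<partial>lborel)"
    by (simp add: nn_integral_cmult)
  also have "\<dots> = (\<integral>\<^sup>+y. (\<integral>\<^sup>+x. \<phi> (y + x) \<partial>\<mu>) * \<psi> y \<partial>lborel)"
    by (simp add: tr)
  also have "\<dots> = (\<integral>\<^sup>+y. (\<integral>\<^sup>+x. \<phi> (y + x) * \<psi> y \<partial>\<mu>) \<partial>lborel)"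
    by (simp add: nn_integral_multc)
  also have "\<dots> = (\<integral>\<^sup>+x. (\<integral>\<^sup>+y. \<phi> (y + x) * \<psi> y \<partial>lborel) \<partial>\<mu>)"
    by (rule Fubini') simp
  also have "\<dots> = (\<integral>\<^sup>+x. (\<integral>\<^sup>+y. \<phi> y * \<psi> (y - x) \<partial>lborel) \<partial>\<mu>)"
  proof (rule nn_integral_cong)
    fix x
    show "(\<integral>\<^sup>+y. \<phi> (y + x) * \<psi> y \<partial>lborel) = (\<integral>\<^sup>+y. \<phi> y * \<psi> (y - x) \<partial>lborel)"
      using trl[of "\<lambda>y. \<phi> y * \<psi> (y - x)" x] by (simp add: add.commute)
  qed
  also have "\<dots> = (\<integral>\<^sup>+y. (\<integral>\<^sup>+x. \<phi> y * \<psi> (y - x) \<partial>\<mu>) \<partial>lborel)"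
    by (rule Fubini'[symmetric]) simp
  also have "\<dots> = (\<integral>\<^sup>+y. \<phi> y * (\<integral>\<^sup>+x. \<psi> (y - x) \<partial>\<mu>) \<partial>lborel)"
    by (simp add: nn_integral_cmult)
  also have "\<dots> = (\<integral>\<^sup>+y. \<phi> y * (\<integral>\<^sup>+x. \<psi> x \<partial>\<mu>) \<partial>lborel)"
  proof (rule nn_integral_cong)
    \<comment> \<open>Here reflection invariance enters: after the substitution in the inner
      integral, \<psi> is evaluated at \<open>y - x\<close>, and \<mu> is known to be invariant only
      under \<open>x \<mapsto> c + x\<close>.\<close>
    fix y
    have "(\<integral>\<^sup>+x. \<psi> (y - x) \<partial>\<mu>) = (\<integral>\<^sup>+x. \<psi> (y + x) \<partial>\<mu>)"
      using rf[of "\<lambda>x. \<psi> (y + x)"] by simp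
    then show "\<phi> y * (\<integral>\<^sup>+x. \<psi> (y - x) \<partial>\<mu>) = \<phi> y * (\<integral>\<^sup>+x. \<psi> x \<partial>\<mu>)"
      using tr[of \<psi> y] by simp
  qed
  also have "\<dots> = (\<integral>\<^sup>+y. \<phi> y \<partial>lborel) * (\<integral>\<^sup>+x. \<psi> x \<partial>\<mu>)"
    by (simp add: nn_integral_multc)
  finally show ?thesis
    by (simp add: \<phi>_def \<psi>_def sets_mu emeasure_lborel_cbox_eq mult.commute)
qed

text \<open>By linearity the image measure inherits invariance under translations and reflection, so
  it is a multiple of \<open>lborel\<close>. The factor is the measure of the preimage of the unit
  cube: finite because that preimage is bounded, nonzero because the whole space has positive
  measure. No determinant has to be computed.\<close>

lemma distr_lborel_linear_iso:
  fixes f :: "'a::euclidean_space \<Rightarrow> 'a"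
  assumes "linear f" "inj f"
  shows "\<exists>c>0. distr lborel borel f = density lborel (\<lambda>_. ennreal c)"
proof -
  obtain g where g: "linear g" "\<And>x. f (g x) = x" "\<And>x. g (f x) = x"
    using linear_injective_isomorphism[OF assms] by blast
  have [measurable]: "f \<in> borel_measurable borel" "g \<in> borel_measurable borel"
    using assms(1) g(1) by (auto intro!: borel_measurable_continuous_onI linear_continuous_on
        simp: linear_linear)
  have image_f: "f ` Y = g -` Y" and vimage_f: "f -` Y = g ` Y" for Y
    using g(2,3) by (auto simp: image_iff) metis+
  define \<mu> where "\<mu> = distr lborel borel f"
  have sf: "sigma_finite_measure \<mu>"
  proof (rule sigma_finite_measure.intro, intro exI conjI)
    let ?A = "range (\<lambda>n::nat. f ` cball 0 (real n))"
    have S: "f ` cball 0 r \<in> sets borel" for r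
      unfolding image_f using measurable_sets[of g borel borel "cball 0 r"] by simp
    show "countable ?A" by simp
    show "?A \<subseteq> sets \<mu>" using S by (auto simp: \<mu>_def)
    show "\<Union>?A = space \<mu>"
    proof -
      have "x \<in> \<Union>?A" for x
      proof -
        obtain n where "norm (g x) \<le> real n" using real_arch_simple by blast
        then show ?thesis by (auto simp: image_f)
      qed
      then show ?thesis by (auto simp: \<mu>_def)
    qed
    show "\<forall>a\<in>?A. emeasure \<mu> a \<noteq> \<infinity>"
    proof
      fix a assume "a \<in> ?A"
      then obtain n :: nat where a: "a = f ` cball 0 (real n)" by blast
      have "f -` a = cball 0 (real n)"
        using assms(2) by (simp add: a inj_vimage_image_eq)
      then show "emeasure \<mu> a \<noteq> \<infinity>"
        using S[of "real n"] emeasure_lborel_cball_finite[of 0 "real n"]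
        by (simp add: less_top \<mu>_def emeasure_distr a)
    qed
  qed
  have trans: "distr \<mu> borel ((+) c) = \<mu>" for c
  proof -
    have "distr \<mu> borel ((+) c) = distr lborel borel (\<lambda>x. c + f x)"
      by (simp add: \<mu>_def distr_distr o_def)
    also have "\<dots> = distr lborel borel (\<lambda>x. f (g c + x))"
      using assms(1) g by (simp add: linear_add)
    also have "\<dots> = distr (distr lborel borel ((+) (g c))) borel f"
      by (subst distr_distr) (auto simp: o_def)
    finally show ?thesis by (simp add: lborel_distr_plus \<mu>_def)
  qed
  have negl: "distr lborel borel uminus = (lborel :: 'a measure)"
    using lborel_affine[of "-1" "0::'a"] by (simp add: density_1)
  have refl: "distr \<mu> borel uminus = \<mu>"
  proof -
    have "distr \<mu> borel uminus = distr lborel borel (\<lambda>x. f (- x))"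
      using assms(1) by (simp add: \<mu>_def distr_distr o_def linear_neg)
    also have "\<dots> = distr (distr lborel borel uminus) borel f"
      by (subst distr_distr) (auto simp: o_def)
    finally show ?thesis by (simp add: negl \<mu>_def)
  qed
  have eq: "emeasure \<mu> X = emeasure \<mu> (cbox 0 One) * emeasure lborel X" if "X \<in> sets borel" for X
    using translation_invariant_eq_scaled_lborel[OF _ sf trans refl that] by (simp add: \<mu>_def)
  have "emeasure \<mu> (cbox 0 One) < \<infinity>"
  proof -
    have "bounded (g ` cbox 0 One)"
      using g(1) by (simp add: bounded_linear_image linear_linear)
    then show ?thesis
      using emeasure_bounded_finite[of "f -` cbox 0 One"] by (simp add: \<mu>_def emeasure_distr vimage_f)
  qed
  then obtain c where c: "c \<ge> 0" "emeasure \<mu> (cbox 0 One) = ennreal c"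
    by (metis ennreal_cases infinity_ennreal_def less_irrefl)
  have "c \<noteq> 0"
  proof
    assume "c = 0"
    then have "emeasure \<mu> UNIV = 0" using eq[of UNIV] c by simp
    then show False by (simp add: \<mu>_def emeasure_distr)
  qed
  moreover have "\<mu> = density lborel (\<lambda>_. ennreal c)"
  proof (rule measure_eqI)
    fix X assume "X \<in> sets \<mu>"
    then have "X \<in> sets borel" by (simp add: \<mu>_def)
    then show "emeasure \<mu> X = emeasure (density lborel (\<lambda>_. ennreal c)) X"
      using eq[of X] c by (simp add: emeasure_density nn_integral_cmult_indicator)
  qed (simp add: \<mu>_def)
  ultimately show ?thesis using c(1) unfolding \<mu>_def by (intro exI[of _ c]) auto
qed

text \<open>The order of the quantifiers matters: \<open>c\<close> is independent of
  \<open>h\<close>. For \<open>h\<close> a wave on a simplex it is thus independent of the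
  frequency, and can be pulled out of an exponential sum as a constant.\<close>

lemma lborel_integral_affine_iso:
  fixes f :: "'a::euclidean_space \<Rightarrow> 'a"
  assumes "linear f" "inj f"
  shows "\<exists>c::real. \<forall>h :: 'a \<Rightarrow> complex. h \<in> borel_measurable borel \<longrightarrow>
      integral\<^sup>L lborel h = of_real c * (\<integral>x. h (v + f x) \<partial>lborel)"
proof -
  obtain c where c: "c > 0" "distr lborel borel f = density lborel (\<lambda>_. ennreal c)"
    using distr_lborel_linear_iso[OF assms] by blast
  have [measurable]: "f \<in> borel_measurable borel"
    using assms(1) by (auto intro!: borel_measurable_continuous_onI linear_continuous_on
        simp: linear_linear)
  have "integral\<^sup>L lborel h = of_real (1 / c) * (\<integral>x. h (v + f x) \<partial>lborel)"
    if [measurable]: "h \<in> borel_measurable borel" for h :: "'a \<Rightarrow> complex"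
  proof -
    have "(\<integral>x. h (v + f x) \<partial>lborel) = (\<integral>x. h (v + x) \<partial>distr lborel borel f)"
      by (subst integral_distr) auto
    also have "\<dots> = c *\<^sub>R (\<integral>x. h (v + x) \<partial>lborel)"
      unfolding c(2) using c(1) by (subst integral_density) auto
    also have "(\<integral>x. h (v + x) \<partial>lborel) = (\<integral>x. h x \<partial>distr lborel borel ((+) v))"
      by (subst integral_distr) auto
    finally show ?thesis using c(1) by (simp add: lborel_distr_plus scaleR_conv_of_real)
  qed
  then show ?thesis by blast
qed

section \<open>Exponential sums and the simplex\<close>

lemma bilin_add_right: "bilin z (x + y) = bilin z x + bilin z y"
  by (simp add: bilin_def algebra_simps sum.distrib)

lemma bilin_scale_left: "bilin (s *s z) x = s * bilin z x"
  by (simp add: bilin_def sum_distrib_left mult.assoc)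

lemma cvec_add: "cvec (x + y) = cvec x + cvec y"
  by (simp add: cvec_def vec_eq_iff)

lemma bilin_cvec_scaleR: "bilin z (cvec (r *\<^sub>R x)) = of_real r * bilin z (cvec x)"
  by (simp add: bilin_def cvec_def sum_distrib_left algebra_simps)

lemma bilin_cvec_sum: "bilin z (cvec (\<Sum>i\<in>A. f i)) = (\<Sum>i\<in>A. bilin z (cvec (f i)))"
proof (induction A rule: infinite_finite_induct)
  case (insert x F)
  then show ?case by (simp add: bilin_add_right cvec_add)
qed (simp_all add: bilin_def cvec_def)

definition wave :: "complex ^ 'n \<Rightarrow> real ^ 'n \<Rightarrow> complex" where
  "wave z x = exp (- 2 * complex_of_real pi * \<i> * bilin z (cvec x))"

lemma wave_add: "wave z (x + y) = wave z x * wave z y"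
  by (simp add: wave_def bilin_add_right cvec_add algebra_simps flip: exp_add)

lemma continuous_on_wave: "continuous_on S (wave z)"
  unfolding wave_def bilin_def cvec_def by (auto intro!: continuous_intros)

lemma borel_measurable_wave [measurable]: "wave z \<in> borel_measurable borel"
  by (intro borel_measurable_continuous_onI continuous_on_wave)

lemma norm_wave_le: "norm (wave z x) \<le> exp (2 * pi * norm (bilin z (cvec x)))"
  unfolding wave_def
  by (rule order.trans[OF norm_exp]) (simp add: norm_mult)

text \<open>Rational functions, homogeneous of degree \<open>- k\<close>, whose denominators are products of
  \<open>k\<close> linear forms with real coefficients.\<close>

inductive frac_form :: "nat \<Rightarrow> (complex ^ 'n \<Rightarrow> complex) \<Rightarrow> bool" where
  zero: "frac_form k (\<lambda>_. 0)"
| const: "frac_form 0 (\<lambda>_. a)"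
| add: "frac_form k f \<Longrightarrow> frac_form k g \<Longrightarrow> frac_form k (\<lambda>z. f z + g z)"
| cmult: "frac_form k f \<Longrightarrow> frac_form k (\<lambda>z. a * f z)"
| divide: "frac_form k f \<Longrightarrow> w \<noteq> 0 \<Longrightarrow> frac_form (Suc k) (\<lambda>z. f z / bilin z (cvec w))"

text \<open>Valid for every \<open>s\<close> and \<open>z\<close>, including \<open>s = 0\<close>
  and zeros of the denominators, since division by zero yields 0 on both sides.\<close>

lemma frac_form_homogeneous:
  "frac_form k f \<Longrightarrow> f (s *s z) = f z / s ^ k"
  by (induction rule: frac_form.induct)
    (auto simp: bilin_scale_left add_divide_distrib)

text \<open>Exponential sums as they arise from Brion's formula. Nothing is said about the values at
  the \<open>z\<close> where one of finitely many real linear forms vanishes.\<close>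

definition exp_form :: "nat \<Rightarrow> (complex ^ 'n \<Rightarrow> complex) \<Rightarrow> bool" where
  "exp_form k F \<longleftrightarrow> (\<exists>V W c. finite V \<and> finite W \<and> 0 \<notin> W \<and> (\<forall>v\<in>V. frac_form k (c v)) \<and>
     (\<forall>z. (\<forall>w\<in>W. bilin z (cvec w) \<noteq> 0) \<longrightarrow> F z = (\<Sum>v\<in>V. c v z * wave z v)))"

lemma exp_formI:
  assumes "finite V" "finite W" "0 \<notin> W" "\<And>v. v \<in> V \<Longrightarrow> frac_form k (c v)"
    "\<And>z. (\<forall>w\<in>W. bilin z (cvec w) \<noteq> 0) \<Longrightarrow> F z = (\<Sum>v\<in>V. c v z * wave z v)"
  shows "exp_form k F"
  using assms unfolding exp_form_def by blast

lemma exp_form_zero: "exp_form k (\<lambda>_. 0)"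
  by (rule exp_formI[of "{}" "{}"]) auto

lemma exp_form_const: "exp_form 0 (\<lambda>_. a)"
  by (rule exp_formI[of "{0}" "{}" _ "\<lambda>_ _. a"])
    (auto intro: frac_form.const simp: wave_def bilin_def cvec_def)

lemma exp_form_add:
  assumes "exp_form k F" "exp_form k G"
  shows "exp_form k (\<lambda>z. F z + G z)"
proof -
  obtain V W c where F: "finite V" "finite W" "0 \<notin> W" "\<And>v. v \<in> V \<Longrightarrow> frac_form k (c v)"
    "\<And>z. (\<forall>w\<in>W. bilin z (cvec w) \<noteq> 0) \<Longrightarrow> F z = (\<Sum>v\<in>V. c v z * wave z v)"
    using assms(1) unfolding exp_form_def by blast
  obtain V' W' c' where G: "finite V'" "finite W'" "0 \<notin> W'" "\<And>v. v \<in> V' \<Longrightarrow> frac_form k (c' v)"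
    "\<And>z. (\<forall>w\<in>W'. bilin z (cvec w) \<noteq> 0) \<Longrightarrow> G z = (\<Sum>v\<in>V'. c' v z * wave z v)"
    using assms(2) unfolding exp_form_def by blast
  \<comment> \<open>The two sets of points may overlap. Extending the coefficients by zero, which is
    a \<open>frac_form\<close> of every degree, allows them to be added over the union.\<close>
  define d where "d v = (if v \<in> V then c v else (\<lambda>_. 0))" for v
  define d' where "d' v = (if v \<in> V' then c' v else (\<lambda>_. 0))" for v
  show ?thesis
  proof (rule exp_formI[of "V \<union> V'" "W \<union> W'" k "\<lambda>v z. d v z + d' v z"])
    show "frac_form k (\<lambda>z. d v z + d' v z)" for v
      by (rule frac_form.add) (auto simp: d_def d'_def F(4) G(4) frac_form.zero)
    fix z assume z: "\<forall>w\<in>W \<union> W'. bilin z (cvec w) \<noteq> 0"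
    have "(\<Sum>v\<in>V. c v z * wave z v) = (\<Sum>v\<in>V \<union> V'. d v z * wave z v)"
      using F(1) G(1) by (intro sum.mono_neutral_cong_left) (auto simp: d_def)
    moreover have "(\<Sum>v\<in>V'. c' v z * wave z v) = (\<Sum>v\<in>V \<union> V'. d' v z * wave z v)"
      using F(1) G(1) by (intro sum.mono_neutral_cong_left) (auto simp: d'_def)
    ultimately show "F z + G z = (\<Sum>v\<in>V \<union> V'. (d v z + d' v z) * wave z v)"
      using F(5)[of z] G(5)[of z] z by (simp add: sum.distrib algebra_simps)
  qed (use F G in auto)
qed

lemma exp_form_sum:
  assumes "\<And>i. i \<in> I \<Longrightarrow> exp_form k (F i)"
  shows "exp_form k (\<lambda>z. \<Sum>i\<in>I. F i z)"
  using assms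
  by (induction I rule: infinite_finite_induct) (auto intro: exp_form_zero exp_form_add)

lemma exp_form_cmult:
  assumes "exp_form k F"
  shows "exp_form k (\<lambda>z. a * F z)"
proof -
  obtain V W c where F: "finite V" "finite W" "0 \<notin> W" "\<And>v. v \<in> V \<Longrightarrow> frac_form k (c v)"
    "\<And>z. (\<forall>w\<in>W. bilin z (cvec w) \<noteq> 0) \<Longrightarrow> F z = (\<Sum>v\<in>V. c v z * wave z v)"
    using assms(1) unfolding exp_form_def by blast
  show ?thesis
    by (rule exp_formI[of V W k "\<lambda>v z. a * c v z"])
      (use F in \<open>auto intro: frac_form.cmult simp: sum_distrib_left mult.assoc\<close>)
qed

lemma exp_form_wave_mult:
  assumes "exp_form k F"
  shows "exp_form k (\<lambda>z. wave z u * F z)"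
proof -
  obtain V W c where F: "finite V" "finite W" "0 \<notin> W" "\<And>v. v \<in> V \<Longrightarrow> frac_form k (c v)"
    "\<And>z. (\<forall>w\<in>W. bilin z (cvec w) \<noteq> 0) \<Longrightarrow> F z = (\<Sum>v\<in>V. c v z * wave z v)"
    using assms(1) unfolding exp_form_def by blast
  show ?thesis
  proof (rule exp_formI[of "(+) u ` V" W k "\<lambda>v. c (v - u)"])
    fix z assume "\<forall>w\<in>W. bilin z (cvec w) \<noteq> 0"
    then show "wave z u * F z = (\<Sum>v\<in>(+) u ` V. c (v - u) z * wave z v)"
      by (simp add: F(5) sum.reindex wave_add sum_distrib_left algebra_simps)
  qed (use F in auto)
qed

lemma exp_form_divide:
  assumes "exp_form k F" "u \<noteq> 0"
  shows "exp_form (Suc k) (\<lambda>z. F z / bilin z (cvec u))"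
proof -
  obtain V W c where F: "finite V" "finite W" "0 \<notin> W" "\<And>v. v \<in> V \<Longrightarrow> frac_form k (c v)"
    "\<And>z. (\<forall>w\<in>W. bilin z (cvec w) \<noteq> 0) \<Longrightarrow> F z = (\<Sum>v\<in>V. c v z * wave z v)"
    using assms(1) unfolding exp_form_def by blast
  show ?thesis
    by (rule exp_formI[of V W _ "\<lambda>v z. c v z / bilin z (cvec u)"])
      (use F assms(2) in \<open>auto intro: frac_form.divide simp: sum_divide_distrib\<close>)
qed

text \<open>Recursions that divide by a linear form hold only off its zero set; that form is simply
  added to the exceptional ones.\<close>

lemma exp_form_cong:
  assumes "exp_form k F" "finite W" "0 \<notin> W"
    "\<And>z. (\<forall>w\<in>W. bilin z (cvec w) \<noteq> 0) \<Longrightarrow> F z = G z"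
  shows "exp_form k G"
proof -
  obtain V W' c where F: "finite V" "finite W'" "0 \<notin> W'" "\<And>v. v \<in> V \<Longrightarrow> frac_form k (c v)"
    "\<And>z. (\<forall>w\<in>W'. bilin z (cvec w) \<noteq> 0) \<Longrightarrow> F z = (\<Sum>v\<in>V. c v z * wave z v)"
    using assms(1) unfolding exp_form_def by blast
  show ?thesis
  proof (rule exp_formI[of V "W \<union> W'" k c])
    fix z assume "\<forall>w\<in>W \<union> W'. bilin z (cvec w) \<noteq> 0"
    then show "G z = (\<Sum>v\<in>V. c v z * wave z v)"
      using F(5)[of z] assms(4)[of z] by simp
  qed (use F assms in auto)
qed

section \<open>The transform of a simplex, one coordinate at a time\<close>

definition unit_simplex :: "'i set \<Rightarrow> ('i \<Rightarrow> real) set" where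
  "unit_simplex A = {x \<in> extensional A. (\<forall>i\<in>A. 0 \<le> x i) \<and> sum x A \<le> 1}"

text \<open>Up to a Jacobian this is the transform of the simplex with vertices 0 and
  \<open>w i\<close> when the \<open>w i\<close> form a basis. The index set is left free so that
  coordinates can be removed one by one while the vectors stay in the same space.\<close>

definition simplex_transform :: "'i set \<Rightarrow> ('i \<Rightarrow> real ^ 'n) \<Rightarrow> complex ^ 'n \<Rightarrow> complex" where
  "simplex_transform A w z =
     (\<integral>x. indicator (unit_simplex A) x *\<^sub>R wave z (\<Sum>i\<in>A. x i *\<^sub>R w i) \<partial>Pi\<^sub>M A (\<lambda>_. lborel))"

lemma unit_simplex_fun_upd:
  assumes "finite A" "j \<notin> A" "x \<in> extensional A"
  shows "x(j := y) \<in> unit_simplex (insert j A) \<longleftrightarrow> x \<in> unit_simplex A \<and> y \<in> {0..1 - sum x A}"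
proof -
  have "sum (x(j := y)) A = sum x A" using assms by (intro sum.cong) auto
  moreover have "x(j := y) \<in> extensional (insert j A)"
    using assms(3) by (auto simp: extensional_def)
  moreover have "(\<forall>i\<in>A. 0 \<le> (x(j := y)) i) \<longleftrightarrow> (\<forall>i\<in>A. 0 \<le> x i)"
    using assms(2) by (auto simp: fun_upd_def)
  ultimately show ?thesis
    using assms by (auto simp: unit_simplex_def)
qed

lemma unit_simplex_sets:
  "finite A \<Longrightarrow> unit_simplex A \<in> sets (Pi\<^sub>M A (\<lambda>_. lborel))"
proof -
  assume "finite A"
  have "unit_simplex A = {x \<in> space (Pi\<^sub>M A (\<lambda>_. lborel)). (\<forall>i\<in>A. 0 \<le> x i) \<and> sum x A \<le> 1}"
    by (auto simp: unit_simplex_def space_PiM PiE_def)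
  also have "\<dots> \<in> sets (Pi\<^sub>M A (\<lambda>_. lborel))"
    using \<open>finite A\<close> by measurable
  finally show ?thesis .
qed

lemma integrable_simplex_transform:
  assumes "finite A"
  shows "integrable (Pi\<^sub>M A (\<lambda>_. lborel))
    (\<lambda>x. indicator (unit_simplex A) x *\<^sub>R wave z (\<Sum>i\<in>A. x i *\<^sub>R w i))"
proof (rule integrableI_bounded_set_indicator)
  show "unit_simplex A \<in> sets (Pi\<^sub>M A (\<lambda>_. lborel))"
    by (rule unit_simplex_sets) fact
  show "(\<lambda>x. wave z (\<Sum>i\<in>A. x i *\<^sub>R w i)) \<in> borel_measurable (Pi\<^sub>M A (\<lambda>_. lborel))"
    by measurable
  have "unit_simplex A = {x. (\<forall>i\<in>A. 0 \<le> x i) \<and> sum x A \<le> 1} \<inter> space (Pi\<^sub>M A (\<lambda>_. lborel))"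
    by (auto simp: unit_simplex_def space_PiM PiE_def)
  then show "emeasure (Pi\<^sub>M A (\<lambda>_. lborel)) (unit_simplex A) < \<infinity>"
    using emeasure_std_simplex_aux[OF assms, of 1]
    by (simp add: ennreal_divide_eq_top_iff less_top)
  have "norm (wave z (\<Sum>i\<in>A. x i *\<^sub>R w i)) \<le> exp (2 * pi * (\<Sum>i\<in>A. norm (bilin z (cvec (w i)))))"
    if x: "x \<in> unit_simplex A" for x
  proof -
    have "x i \<le> 1" if "i \<in> A" for i
      using x member_le_sum[of i A x] assms that by (auto simp: unit_simplex_def)
    then have "norm (bilin z (cvec (\<Sum>i\<in>A. x i *\<^sub>R w i))) \<le> (\<Sum>i\<in>A. norm (bilin z (cvec (w i))))"
      using x unfolding bilin_cvec_sum bilin_cvec_scaleR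
      by (intro order.trans[OF norm_sum] sum_mono)
        (auto simp: norm_mult unit_simplex_def intro: mult_left_le_one_le)
    then show ?thesis
      by (intro order.trans[OF norm_wave_le]) simp
  qed
  then show "AE x in Pi\<^sub>M A (\<lambda>_. lborel). x \<in> unit_simplex A \<longrightarrow>
      norm (wave z (\<Sum>i\<in>A. x i *\<^sub>R w i)) \<le> exp (2 * pi * (\<Sum>i\<in>A. norm (bilin z (cvec (w i)))))"
    by auto
qed

lemma integral_wave_segment:
  assumes "bilin z (cvec u) \<noteq> 0" "r \<ge> 0"
  shows "(\<integral>y. indicator {0..r} y *\<^sub>R wave z (y *\<^sub>R u) \<partial>lborel) =
    (wave z (r *\<^sub>R u) - 1) / (- 2 * complex_of_real pi * \<i> * bilin z (cvec u))"
proof -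
  define \<beta> where "\<beta> = - 2 * complex_of_real pi * \<i> * bilin z (cvec u)"
  have \<beta>: "\<beta> \<noteq> 0" using assms(1) by (simp add: \<beta>_def)
  have w: "wave z (y *\<^sub>R u) = exp (\<beta> * of_real y)" for y
    by (simp add: wave_def bilin_cvec_scaleR \<beta>_def algebra_simps)
  have "(\<integral>y. indicator {0..r} y *\<^sub>R exp (\<beta> * of_real y) \<partial>lborel) =
      exp (\<beta> * of_real r) / \<beta> - exp (\<beta> * of_real 0) / \<beta>"
  proof (rule integral_FTC_atLeastAtMost)
    fix y :: real
    have "((\<lambda>y. exp (\<beta> * y) / \<beta>) has_field_derivative exp (\<beta> * of_real y)) (at (of_real y))"
      using \<beta> by (auto intro!: derivative_eq_intros)
    from has_vector_derivative_real_field[OF this]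
    show "((\<lambda>y. exp (\<beta> * of_real y) / \<beta>) has_vector_derivative exp (\<beta> * of_real y)) (at y within {0..r})"
      by (simp add: o_def has_vector_derivative_at_within)
  qed (use assms in \<open>auto intro!: continuous_intros\<close>)
  then show ?thesis unfolding w by (simp add: \<beta>_def diff_divide_distrib)
qed

text \<open>Integrating out the coordinate \<open>j\<close> leaves two boundary terms. The lower end
  gives the facet with vertices 0 and \<open>w i\<close>. The upper end gives the facet opposite the
  origin, which after translation by \<open>- w j\<close> has vertices 0 and
  \<open>w i - w j\<close>.\<close>

lemma simplex_transform_insert:
  assumes A: "finite A" "j \<notin> A" and z: "bilin z (cvec (w j)) \<noteq> 0"
  shows "simplex_transform (insert j A) w z =
    (wave z (w j) * simplex_transform A (\<lambda>i. w i - w j) z - simplex_transform A w z) /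
    (- 2 * complex_of_real pi * \<i> * bilin z (cvec (w j)))"
proof -
  define \<beta> where "\<beta> = - 2 * complex_of_real pi * \<i> * bilin z (cvec (w j))"
  interpret product_sigma_finite "\<lambda>_. lborel" by standard
  have "simplex_transform (insert j A) w z = (\<integral>x. (\<integral>y. indicator (unit_simplex (insert j A)) (x(j := y)) *\<^sub>R
      wave z (\<Sum>i\<in>insert j A. (x(j := y)) i *\<^sub>R w i) \<partial>lborel) \<partial>Pi\<^sub>M A (\<lambda>_. lborel))"
    unfolding simplex_transform_def
    by (rule product_integral_insert[OF A integrable_simplex_transform]) (use A in simp)
  also have "\<dots> = (\<integral>x. (wave z (w j) * (indicator (unit_simplex A) x *\<^sub>R wave z (\<Sum>i\<in>A. x i *\<^sub>R (w i - w j)))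
      - indicator (unit_simplex A) x *\<^sub>R wave z (\<Sum>i\<in>A. x i *\<^sub>R w i)) / \<beta> \<partial>Pi\<^sub>M A (\<lambda>_. lborel))"
  proof (rule Bochner_Integration.integral_cong[OF refl])
    fix x assume "x \<in> space (Pi\<^sub>M A (\<lambda>_. lborel :: real measure))"
    then have x: "x \<in> extensional A" by (simp add: space_PiM PiE_def)
    let ?s = "\<Sum>i\<in>A. x i *\<^sub>R w i"
    have "(\<Sum>i\<in>A. (x(j := y)) i *\<^sub>R w i) = ?s" for y
      using A by (intro sum.cong) auto
    then have "(\<integral>y. indicator (unit_simplex (insert j A)) (x(j := y)) *\<^sub>R
        wave z (\<Sum>i\<in>insert j A. (x(j := y)) i *\<^sub>R w i) \<partial>lborel) =
      (\<integral>y. (indicator (unit_simplex A) x *\<^sub>R wave z ?s) *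
        (indicator {0..1 - sum x A} y *\<^sub>R wave z (y *\<^sub>R w j)) \<partial>lborel)"
      using A unit_simplex_fun_upd[OF A x]
      by (intro Bochner_Integration.integral_cong refl) (auto simp: indicator_def wave_add)
    also have "\<dots> = (indicator (unit_simplex A) x *\<^sub>R wave z ?s) *
        (\<integral>y. indicator {0..1 - sum x A} y *\<^sub>R wave z (y *\<^sub>R w j) \<partial>lborel)"
      by (rule integral_mult_right_zero)
    also have "\<dots> = (wave z (w j) * (indicator (unit_simplex A) x *\<^sub>R wave z (\<Sum>i\<in>A. x i *\<^sub>R (w i - w j)))
      - indicator (unit_simplex A) x *\<^sub>R wave z ?s) / \<beta>"
    proof (cases "x \<in> unit_simplex A")
      case True
      then have "0 \<le> 1 - sum x A" by (simp add: unit_simplex_def)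
      note I = integral_wave_segment[OF z this]
      have "?s + (1 - sum x A) *\<^sub>R w j = w j + (\<Sum>i\<in>A. x i *\<^sub>R (w i - w j))"
        by (simp add: algebra_simps sum_subtractf scaleR_sum_left)
      from arg_cong[OF this, of "wave z"] have "wave z ?s * wave z ((1 - sum x A) *\<^sub>R w j) =
          wave z (w j) * wave z (\<Sum>i\<in>A. x i *\<^sub>R (w i - w j))"
        unfolding wave_add .
      then show ?thesis using True unfolding I \<beta>_def[symmetric]
        by (simp add: algebra_simps)
    qed simp
    finally show "(\<integral>y. indicator (unit_simplex (insert j A)) (x(j := y)) *\<^sub>R
        wave z (\<Sum>i\<in>insert j A. (x(j := y)) i *\<^sub>R w i) \<partial>lborel) = \<dots>" .
  qed
  also have "\<dots> = (wave z (w j) * simplex_transform A (\<lambda>i. w i - w j) z - simplex_transform A w z) / \<beta>"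
    unfolding simplex_transform_def integral_divide_zero
    by (subst Bochner_Integration.integral_diff)
      (intro integrable_mult_right integrable_simplex_transform A(1)
        | simp only: integral_mult_right_zero)+
  finally show ?thesis by (simp add: \<beta>_def)
qed

text \<open>Distinct and nonzero is a condition that survives both branches of the recursion, since
  the differences \<open>w i - w j\<close> are again distinct and nonzero. Each coordinate costs one
  division by a linear form, hence the degree \<open>card A\<close>.\<close>

lemma exp_form_simplex_transform:
  assumes "finite A" "inj_on w A" "0 \<notin> w ` A"
  shows "exp_form (card A) (simplex_transform A w)"
  using assms
proof (induction arbitrary: w rule: finite_induct)
  case empty
  have "simplex_transform {} w = (\<lambda>_. 1)"
    by (rule ext) (simp add: simplex_transform_def unit_simplex_def PiM_empty wave_def bilin_def cvec_def
        lebesgue_integral_count_space_finite)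
  then show ?case by (simp add: exp_form_const)
next
  case (insert j A)
  have wj: "w j \<noteq> 0" using insert.prems by auto
  have 1: "exp_form (card A) (simplex_transform A w)"
    using insert.prems by (intro insert.IH) auto
  have 2: "exp_form (card A) (simplex_transform A (\<lambda>i. w i - w j))"
  proof (rule insert.IH)
    show "inj_on (\<lambda>i. w i - w j) A" using insert.prems(1) by (simp add: inj_on_def)
    show "0 \<notin> (\<lambda>i. w i - w j) ` A" using insert.prems(1) insert.hyps(2) by (auto simp: inj_on_def)
  qed
  have "exp_form (Suc (card A)) (\<lambda>z. (wave z (w j) * simplex_transform A (\<lambda>i. w i - w j) z +
      (-1) * simplex_transform A w z) / bilin z (cvec (w j)))"
    by (intro exp_form_divide exp_form_add exp_form_wave_mult exp_form_cmult 1 2 wj)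
  from exp_form_cmult[OF this, of "1 / (- 2 * complex_of_real pi * \<i>)"]
  have "exp_form (Suc (card A)) (simplex_transform (insert j A) w)"
  proof (rule exp_form_cong[where W = "{w j}"])
    fix z assume "\<forall>u\<in>{w j}. bilin z (cvec u) \<noteq> 0"
    then show "1 / (- 2 * complex_of_real pi * \<i>) * ((wave z (w j) * simplex_transform A (\<lambda>i. w i - w j) z +
        (-1) * simplex_transform A w z) / bilin z (cvec (w j))) = simplex_transform (insert j A) w z"
      by (simp add: simplex_transform_insert insert.hyps)
  qed (use wj in auto)
  then show ?case using insert.hyps by simp
qed

section \<open>Polytopal regions\<close>

lemma fourier_laplace_eq_wave: "fourier_laplace P z = (LINT x:P|lebesgue. wave z x)"
  by (simp add: fourier_laplace_def wave_def)

lemma set_integrable_wave: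
  fixes P :: "(real ^ 'n) set"
  assumes "compact P"
  shows "set_integrable lebesgue P (wave z)"
proof -
  have [measurable]: "P \<in> sets borel" using assms by (rule borel_compact)
  have "(\<lambda>x. indicator P x *\<^sub>R wave z x) \<in> borel_measurable lborel" by measurable
  then show ?thesis
    using borel_integrable_compact[OF assms continuous_on_wave[of P z]]
    unfolding set_integrable_def by (simp add: integrable_completion)
qed

lemma fourier_laplace_eq_lborel:
  fixes P :: "(real ^ 'n) set"
  assumes "compact P"
  shows "fourier_laplace P z = (\<integral>x. indicator P x *\<^sub>R wave z x \<partial>lborel)"
proof -
  have [measurable]: "P \<in> sets borel" using assms by (simp add: borel_compact)
  show ?thesis
    unfolding fourier_laplace_eq_wave set_lebesgue_integral_def
    by (rule integral_completion) measurable
qed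

lemma fourier_laplace_Union:
  fixes F :: "(real ^ 'n) set set"
  assumes "finite F" "\<And>Q. Q \<in> F \<Longrightarrow> compact Q"
    and "pairwise (\<lambda>Q R. negligible (Q \<inter> R)) F"
  shows "fourier_laplace (\<Union>F) z = (\<Sum>Q\<in>F. fourier_laplace Q z)"
proof (rule has_integral_unique)
  have "compact (\<Union>F)" using assms by (intro compact_Union) auto
  then show "(wave z has_integral fourier_laplace (\<Union>F) z) (\<Union>F)"
    unfolding fourier_laplace_eq_wave by (intro has_integral_set_lebesgue set_integrable_wave)
  show "(wave z has_integral (\<Sum>Q\<in>F. fourier_laplace Q z)) (\<Union>F)"
    unfolding fourier_laplace_eq_wave
    by (intro has_integral_Union has_integral_set_lebesgue set_integrable_wave assms)
qed

lemma exp_form_fourier_laplace_Union: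
  fixes F :: "(real ^ 'n) set set"
  assumes "finite F" "\<And>Q. Q \<in> F \<Longrightarrow> compact Q"
    and "pairwise (\<lambda>Q R. negligible (Q \<inter> R)) F"
    and "\<And>Q. Q \<in> F \<Longrightarrow> exp_form k (fourier_laplace Q)"
  shows "exp_form k (fourier_laplace (\<Union>F))"
proof -
  have "fourier_laplace (\<Union>F) = (\<lambda>z. \<Sum>Q\<in>F. fourier_laplace Q z)"
    by (rule ext) (rule fourier_laplace_Union[OF assms(1-3)])
  then show ?thesis using assms(4) by (simp add: exp_form_sum)
qed

section \<open>From the standard simplex to polytopes by triangulation\<close>

lemma integral_std_simplex_wave:
  fixes f :: "real ^ 'n \<Rightarrow> real ^ 'n"
  assumes "linear f"
  shows "(\<integral>x. indicator (convex hull (insert 0 Basis)) x *\<^sub>R wave z (f x) \<partial>lborel) =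
    simplex_transform Basis f z"
proof -
  have [measurable]: "f \<in> borel_measurable borel"
    using assms by (auto intro!: borel_measurable_continuous_onI linear_continuous_on
        simp: linear_linear)
  have [measurable]: "convex hull (insert 0 Basis) \<in> sets (borel :: (real ^ 'n) measure)"
    by (intro borel_compact finite_imp_compact_convex_hull) simp
  have "(\<integral>x. indicator (convex hull (insert 0 Basis)) x *\<^sub>R wave z (f x) \<partial>lborel) =
    (\<integral>y. indicator (convex hull (insert 0 Basis)) (\<Sum>b\<in>Basis. y b *\<^sub>R b) *\<^sub>R
        wave z (f (\<Sum>b\<in>Basis. y b *\<^sub>R b)) \<partial>Pi\<^sub>M Basis (\<lambda>_. lborel))"
    by (subst lborel_eq, subst integral_distr) auto
  also have "\<dots> = simplex_transform Basis f z"
    unfolding simplex_transform_def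
  proof (rule Bochner_Integration.integral_cong[OF refl])
    fix y assume "y \<in> space (Pi\<^sub>M (Basis :: (real ^ 'n) set) (\<lambda>_. lborel :: real measure))"
    then have "y \<in> extensional Basis" by (simp add: space_PiM PiE_def)
    then have "(\<Sum>b\<in>Basis. y b *\<^sub>R b) \<in> convex hull (insert 0 Basis) \<longleftrightarrow> y \<in> unit_simplex Basis"
      unfolding std_simplex unit_simplex_def by simp
    moreover have "f (\<Sum>b\<in>Basis. y b *\<^sub>R b) = (\<Sum>b\<in>Basis. y b *\<^sub>R f b)"
      using assms by (simp add: linear_sum linear_cmul)
    ultimately show "indicator (convex hull (insert 0 Basis)) (\<Sum>b\<in>Basis. y b *\<^sub>R b) *\<^sub>R
        wave z (f (\<Sum>b\<in>Basis. y b *\<^sub>R b)) =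
        indicator (unit_simplex Basis) y *\<^sub>R wave z (\<Sum>b\<in>Basis. y b *\<^sub>R f b)"
      by (simp add: indicator_def)
  qed
  finally show ?thesis .
qed

text \<open>Once a vertex \<open>v\<close> is moved to the origin, affine independence of the
  vertices becomes linear independence of the edge vectors at \<open>v\<close>. There are as many of
  these as coordinates, so \<open>f\<close> can send the standard basis to them.\<close>

lemma full_simplex_eq_affine_image:
  fixes T :: "(real ^ 'n) set"
  assumes "int CARD('n) simplex T"
  obtains v and f :: "real ^ 'n \<Rightarrow> real ^ 'n"
  where "linear f" "inj f" "T = (\<lambda>x. v + f x) ` (convex hull (insert 0 Basis))"
proof -
  obtain C where C: "finite C" "\<not> affine_dependent C" "int (card C) = int CARD('n) + 1"
    "T = convex hull C"
    using assms by (auto simp: simplex)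
  obtain v where v: "v \<in> C" using C(3) by fastforce
  have "card (C - {v}) = card (Basis :: (real ^ 'n) set)"
    using C v by simp
  then obtain h where h: "bij_betw h (Basis :: (real ^ 'n) set) (C - {v})"
    using C(1) by (metis finite_Basis finite_Diff finite_same_card_bij)
  define f where "f x = (\<Sum>b\<in>Basis. (x \<bullet> b) *\<^sub>R (h b - v))" for x :: "real ^ 'n"
  have lin: "linear f"
    by (rule linearI)
      (simp_all add: f_def inner_add_left scaleR_add_left sum.distrib scaleR_sum_right)
  have fb: "f b = h b - v" if "b \<in> Basis" for b
    using that by (simp add: f_def inner_Basis if_distrib[of "\<lambda>r. r *\<^sub>R _"] sum.delta cong: if_cong)
  define B where "B = (\<lambda>x. - v + x) ` (C - {v})"
  have fB: "f ` Basis = B"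
  proof -
    have "f ` Basis = (\<lambda>x. - v + x) ` (h ` Basis)"
      using fb by (force simp: image_iff)
    then show ?thesis using h by (simp add: B_def bij_betw_def)
  qed
  have "independent B"
    using C(2) affine_dependent_iff_dependent2[OF v] by (simp add: B_def)
  moreover have "card B = DIM(real ^ 'n)"
    using C v by (simp add: B_def card_image)
  ultimately have "span B = UNIV"
    using card_ge_dim_independent[of B UNIV] by (auto simp: dim_UNIV)
  then have "surj f"
    using lin fB by (metis linear_span_image span_Basis)
  then have inj: "inj f" using lin by (simp add: linear_surjective_imp_injective)
  have "T = (+) v ` (convex hull ((+) (-v) ` C))"
    by (simp only: C(4) convex_hull_translation image_image) simp
  also have "(+) (-v) ` C = f ` insert 0 Basis"
    using v lin by (auto simp: fB B_def linear_0 image_iff)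
  also have "convex hull (f ` insert 0 Basis) = f ` (convex hull insert 0 Basis)"
    by (rule convex_hull_linear_image[OF lin, symmetric])
  finally have "T = (\<lambda>x. v + f x) ` (convex hull (insert 0 Basis))"
    by (simp add: image_image)
  with lin inj show ?thesis using that by blast
qed

lemma exp_form_fourier_laplace_simplex:
  fixes T :: "(real ^ 'n) set"
  assumes "int CARD('n) simplex T"
  shows "exp_form CARD('n) (fourier_laplace T)"
proof -
  let ?S = "convex hull (insert 0 Basis) :: (real ^ 'n) set"
  obtain v f where f: "linear f" "inj f" and T: "T = (\<lambda>x. v + f x) ` ?S"
    using full_simplex_eq_affine_image[OF assms] by blast
  obtain c where c: "\<And>h. h \<in> borel_measurable borel \<Longrightarrow>
      integral\<^sup>L lborel h = complex_of_real c * (\<integral>x. h (v + f x) \<partial>lborel)"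
    using lborel_integral_affine_iso[OF f] by blast
  have "compact ?S" by (intro finite_imp_compact_convex_hull) simp
  then have cT: "compact T" unfolding T
    using f(1) by (intro compact_continuous_image continuous_intros linear_continuous_on)
      (auto simp: linear_linear)
  then have [measurable]: "T \<in> sets borel" by (rule borel_compact)
  have mem: "v + f x \<in> T \<longleftrightarrow> x \<in> ?S" for x
    by (auto simp: T image_iff inj_eq[OF f(2)])
  have "fourier_laplace T z = of_real c * (wave z v * simplex_transform Basis f z)" for z
  proof -
    have "fourier_laplace T z = of_real c * (\<integral>x. indicator T (v + f x) *\<^sub>R wave z (v + f x) \<partial>lborel)"
      unfolding fourier_laplace_eq_lborel[OF cT] by (rule c) measurable
    also have "(\<integral>x. indicator T (v + f x) *\<^sub>R wave z (v + f x) \<partial>lborel) =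
      (\<integral>x. wave z v * (indicator ?S x *\<^sub>R wave z (f x)) \<partial>lborel)"
      by (intro Bochner_Integration.integral_cong refl) (simp add: indicator_def mem wave_add)
    finally show ?thesis by (simp only: integral_mult_right_zero integral_std_simplex_wave[OF f(1)])
  qed
  then have "fourier_laplace T = (\<lambda>z. of_real c * (wave z v * simplex_transform Basis f z))"
    by blast
  moreover have "exp_form CARD('n) (simplex_transform Basis f)"
  proof -
    have "inj_on f Basis" using f(2) by (auto simp: inj_on_def)
    moreover have "0 \<notin> f ` Basis"
      using f by (auto simp: linear_injective_0)
    ultimately show ?thesis
      using exp_form_simplex_transform[of Basis f] by simp
  qed
  ultimately show ?thesis
    by (simp add: exp_form_cmult exp_form_wave_mult)
qed

lemma exp_form_fourier_laplace_polytope: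
  fixes Q :: "(real ^ 'n) set"
  assumes "polytope Q" "aff_dim Q = int CARD('n)"
  shows "exp_form CARD('n) (fourier_laplace Q)"
proof -
  \<comment> \<open>The bound 1 on the diameters of the cells is an arbitrary choice.\<close>
  obtain \<T> where T: "triangulation \<T>" "\<And>T. T \<in> \<T> \<Longrightarrow> aff_dim T = int CARD('n)" "\<Union>\<T> = Q"
    by (rule fine_triangular_subdivision_of_cell_complex[of 1 "{Q}" "int CARD('n)"])
      (use assms in \<open>auto simp: face_of_refl polytope_imp_convex\<close>)
  have simp_T: "int CARD('n) simplex T" if "T \<in> \<T>" for T
    using T that unfolding triangulation_def by (metis aff_dim_simplex)
  have face: "T \<inter> T' face_of T" if "T \<in> \<T>" "T' \<in> \<T>" for T T'
    using T(1) that by (auto simp: triangulation_def)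
  have conv: "convex T" "compact T" if "T \<in> \<T>" for T
    using simp_T[OF that] by (auto simp: simplex intro: finite_imp_compact_convex_hull)
  \<comment> \<open>The asymmetric condition suffices: for distinct cells the intersection is a
    proper face of at least one of them, so it has smaller dimension.\<close>
  have proper: "negligible (T \<inter> T')" if "T \<in> \<T>" "T' \<in> \<T>" "T \<inter> T' \<noteq> T" for T T'
  proof -
    have "aff_dim (T \<inter> T') < int CARD('n)"
      using face_of_aff_dim_lt[OF conv(1) face] that T(2) by metis
    then have "interior (T \<inter> T') = {}"
      using aff_dim_nonempty_interior[of "T \<inter> T'"] by auto
    then show ?thesis
      using negligible_convex_interior conv(1) that by (metis convex_Int)
  qed
  have "pairwise (\<lambda>T T'. negligible (T \<inter> T')) \<T>"
    unfolding pairwise_def using proper by (metis inf_commute)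
  then have "exp_form CARD('n) (fourier_laplace (\<Union>\<T>))"
    using T(1) conv simp_T
    by (intro exp_form_fourier_laplace_Union exp_form_fourier_laplace_simplex)
      (auto simp: triangulation_def)
  then show ?thesis using T(3) by simp
qed

lemma compact_polytopal_region:
  assumes "polytopal_region P"
  shows "compact P"
  using assms unfolding polytopal_region_def by (auto intro: compact_Union polytope_imp_compact)

text \<open>The pieces need not meet in common faces, so each is triangulated by itself. Their
  overlaps are null because a convex set with empty interior is null.\<close>

lemma exp_form_fourier_laplace_polytopal_region:
  fixes P :: "(real ^ 'n) set"
  assumes "polytopal_region P"
  shows "exp_form CARD('n) (fourier_laplace P)"
proof -
  obtain F where F: "finite F" "\<And>Q. Q \<in> F \<Longrightarrow> polytope Q"
    "\<And>Q. Q \<in> F \<Longrightarrow> aff_dim Q = int CARD('n)"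
    "pairwise (\<lambda>Q R. disjnt (interior Q) (interior R)) F" "P = \<Union>F"
    using assms unfolding polytopal_region_def by blast
  have "negligible (Q \<inter> R)" if "Q \<in> F" "R \<in> F" "Q \<noteq> R" for Q R
  proof -
    have "interior (Q \<inter> R) = {}"
      using F(4) that by (auto simp: pairwise_def disjnt_def)
    moreover have "convex (Q \<inter> R)"
      using F(2) that by (simp add: convex_Int polytope_imp_convex)
    ultimately show ?thesis by (simp add: negligible_convex_interior)
  qed
  then have "pairwise (\<lambda>Q R. negligible (Q \<inter> R)) F" by (auto simp: pairwise_def)
  then show ?thesis
    unfolding F(5) using F
    by (intro exp_form_fourier_laplace_Union exp_form_fourier_laplace_polytope)
      (auto intro: polytope_imp_compact)
qed

section \<open>The value at the origin\<close>

lemma fourier_laplace_0_polytopal_region: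
  fixes P :: "(real ^ 'n) set"
  assumes "polytopal_region P"
  shows "fourier_laplace P 0 \<noteq> 0"
proof
  assume "fourier_laplace P 0 = 0"
  obtain F Q where Q: "Q \<in> F" "polytope Q" "aff_dim Q = int CARD('n)" "P = \<Union>F"
    using assms unfolding polytopal_region_def by blast
  have P: "P \<in> lmeasurable" using compact_polytopal_region[OF assms] by (rule lmeasurable_compact)
  have "wave (0 :: complex ^ 'n) = (\<lambda>_. 1)" by (auto simp: wave_def bilin_def)
  then have "fourier_laplace P 0 = of_real (measure lebesgue P)"
    using P by (simp add: fourier_laplace_eq_wave set_lebesgue_integral_def scaleR_conv_of_real fmeasurable_def)
  then have "measure lebesgue P = 0" using \<open>fourier_laplace P 0 = 0\<close> by simp
  then have "negligible P" using P by (simp add: negligible_iff_measure)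
  then have "negligible Q" by (rule negligible_subset) (use Q in blast)
  then have "interior Q = {}"
    using Q(2) by (simp add: negligible_convex_interior polytope_imp_convex)
  moreover have "affine hull Q = UNIV" using Q(3) aff_dim_eq_full[of Q] by simp
  ultimately have "rel_interior Q = {}" by (simp add: rel_interior_interior)
  then have "Q = {}" using Q(2) by (simp add: rel_interior_eq_empty polytope_imp_convex)
  then show False using Q(3) by simp
qed

text \<open>An exponential sum with exceptional forms says nothing at the origin, where all of them
  vanish; the value there is recovered along a line. The factors have modulus at most 1, so the
  bound for \<open>wave z\<close> dominates the whole sequence.\<close>

lemma fourier_laplace_scale_tendsto:
  fixes P :: "(real ^ 'n) set"
  assumes "compact P"
  shows "(\<lambda>n. fourier_laplace P (of_real (1 / real (Suc n)) *s z)) \<longlonglongrightarrow> fourier_laplace P 0"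
proof -
  have [measurable]: "P \<in> sets borel" using assms by (rule borel_compact)
  let ?B = "\<lambda>x. indicator P x *\<^sub>R exp (2 * pi * norm (bilin z (cvec x)))"
  let ?s = "\<lambda>n. complex_of_real (1 / real (Suc n))"
  have s: "?s \<longlonglongrightarrow> 0"
    using tendsto_of_real[OF LIMSEQ_inverse_real_of_nat, where 'a = complex]
    by (simp add: inverse_eq_divide)
  show ?thesis
    unfolding fourier_laplace_eq_lborel[OF assms]
  proof (rule integral_dominated_convergence[where w = ?B])
    show "integrable lborel ?B"
      by (rule borel_integrable_compact[OF assms])
        (auto simp: bilin_def cvec_def intro!: continuous_intros)
    have "(\<lambda>n. wave (?s n *s z) x) \<longlonglongrightarrow> wave 0 x" for x :: "real ^ 'n"
    proof -
      have "(\<lambda>n. exp (- 2 * complex_of_real pi * \<i> * (?s n * bilin z (cvec x))))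
          \<longlonglongrightarrow> exp (- 2 * complex_of_real pi * \<i> * (0 * bilin z (cvec x)))"
        by (intro tendsto_intros s)
      then show ?thesis unfolding wave_def bilin_scale_left by (simp add: bilin_def)
    qed
    then show "AE x in lborel. (\<lambda>n. indicator P x *\<^sub>R wave (?s n *s z) x)
        \<longlonglongrightarrow> indicator P x *\<^sub>R wave 0 x"
      by (auto intro!: tendsto_intros)
    have "norm (wave (?s n *s z) x) \<le> exp (2 * pi * norm (bilin z (cvec x)))" for n and x :: "real ^ 'n"
    proof (rule order.trans[OF norm_wave_le])
      have "norm (?s n) \<le> 1" by (simp only: norm_of_real) simp
      then show "exp (2 * pi * norm (bilin (?s n *s z) (cvec x))) \<le> exp (2 * pi * norm (bilin z (cvec x)))"
        unfolding bilin_scale_left norm_mult by (simp add: mult_left_le_one_le)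
    qed
    then show "AE x in lborel. norm (indicator P x *\<^sub>R wave (?s n *s z) x) \<le> ?B x" for n
      by (auto simp: indicator_def)
  qed measurable
qed

section \<open>Rational curves\<close>

text \<open>Stated over an arbitrary field so that it serves complex and real hyperplanes
  alike.\<close>

lemma affine_hyperplane_linear_equation:
  fixes w :: "'a::field ^ 'n"
  assumes "w \<noteq> 0"
  shows "affine_hyperplane {x. (\<Sum>i\<in>UNIV. x $ i * w $ i) = c}"
proof -
  define l where "l x = (\<Sum>i\<in>UNIV. x $ i * w $ i)" for x :: "'a ^ 'n"
  have l_add: "l (x + y) = l x + l y" and l_scale: "l (r *s x) = r * l x" for x y r
    by (simp_all add: l_def algebra_simps sum.distrib sum_distrib_left)
  have l_diff: "l (x - y) = l x - l y" for x y
    by (simp add: l_def algebra_simps sum_subtractf)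
  obtain k where k: "w $ k \<noteq> 0" using assms by (auto simp: vec_eq_iff)
  \<comment> \<open>A vector on which the form \<open>l\<close> takes the value 1: it completes the
    kernel \<open>V\<close> to the whole space, and \<open>c *s e\<close> is a base point of the
    level set.\<close>
  define e where "e = axis k (inverse (w $ k))"
  have le: "l e = 1"
    using k by (simp add: l_def e_def axis_def if_distrib[of "\<lambda>r. r * _"] sum.delta cong: if_cong)
  define V where "V = {x. l x = 0}"
  have sub: "vec.subspace V"
    by (auto simp: V_def vec.subspace_def l_add l_scale) (simp add: l_def)
  have span: "vec.span V = V" using sub by (simp add: vec.span_eq_iff)
  have "x \<in> vec.span (insert e V)" for x
  proof -
    have "l (x - l x *s e) = 0"
      by (simp add: l_diff l_scale le)
    then have "x - l x *s e \<in> vec.span V" unfolding span by (simp add: V_def)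
    then show ?thesis unfolding vec.span_insert by blast
  qed
  then have "vec.dim (insert e V) = CARD('n)"
    by (metis UNIV_eq_I vec.dim_span vec_dim_card)
  then have "vec.dim V = CARD('n) - 1"
    using le by (simp add: vec.dim_insert span) (simp add: V_def)
  moreover have "{x. l x = c} = (\<lambda>v. c *s e + v) ` V"
  proof (intro equalityI subsetI)
    fix x assume "x \<in> {x. l x = c}"
    then have "l (x - c *s e) = 0"
      by (simp add: l_diff l_scale le)
    then show "x \<in> (\<lambda>v. c *s e + v) ` V"
      by (intro image_eqI[of _ _ "x - c *s e"]) (auto simp: V_def)
  qed (auto simp: V_def l_add l_scale le)
  ultimately show ?thesis using sub unfolding affine_hyperplane_def l_def by blast
qed

text \<open>The common core of both claims: being contained in no hyperplane, complex or real, is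
  used only through nonconstancy of the linear forms with real \<open>w\<close>.\<close>

lemma fourier_laplace_nonzero_on_rational_curve:
  fixes \<gamma> :: "real \<Rightarrow> complex ^ 'n" and P :: "(real ^ 'n) set"
  assumes "rational_curve \<gamma>" and P: "polytopal_region P"
    and nonconst: "\<And>w k. w \<noteq> 0 \<Longrightarrow> \<not> (\<forall>t\<in>{0..1}. bilin (\<gamma> t) (cvec w) = k)"
  shows "\<not> (\<forall>t\<in>{0..1}. fourier_laplace P (\<gamma> t) = 0)"
proof
  assume vanish: "\<forall>t\<in>{0..1}. fourier_laplace P (\<gamma> t) = 0"
  obtain p q :: "'n \<Rightarrow> complex poly" where pq: "\<And>i t. t \<in> {0..1} \<Longrightarrow>
      poly (q i) (of_real t) \<noteq> 0 \<and> \<gamma> t $ i = poly (p i) (of_real t) / poly (q i) (of_real t)"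
    using assms(1) unfolding rational_curve_def by metis
  \<comment> \<open>A common denominator for all coordinates; \<open>L w\<close> is then the
    numerator of \<open>bilin (\<gamma> t) (cvec w)\<close> and is additive in
    \<open>w\<close>.\<close>
  define b where "b = (\<Prod>i\<in>UNIV. q i)"
  define L where "L w = (\<Sum>i\<in>UNIV. smult (of_real (w $ i)) (p i * (\<Prod>j\<in>UNIV - {i}. q j)))"
    for w :: "real ^ 'n"
  have b: "poly b (of_real t) \<noteq> 0" if "t \<in> {0..1}" for t
    using pq[OF that] by (simp add: b_def poly_prod)
  have L: "bilin (\<gamma> t) (cvec w) = poly (L w) (of_real t) / poly b (of_real t)"
    if t: "t \<in> {0..1}" for t w
  proof -
    have "\<gamma> t $ i = poly (p i * (\<Prod>j\<in>UNIV - {i}. q j)) (of_real t) / poly b (of_real t)" for i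
    proof -
      have "b = q i * (\<Prod>j\<in>UNIV - {i}. q j)"
        unfolding b_def by (rule prod.remove) auto
      then show ?thesis using pq[OF t, of i] b[OF t] by auto
    qed
    then show ?thesis
      by (simp add: bilin_def cvec_def L_def poly_sum sum_divide_distrib mult.commute)
  qed
  have L_diff: "L v - L w = L (v - w)" for v w
    by (simp add: L_def smult_diff_left flip: sum_subtractf)
  have L_nonconst: "L w \<noteq> smult k b" if "w \<noteq> 0" for w k
    using nonconst[OF that, of k] L b by auto
  have L_nz: "L w \<noteq> 0" if "w \<noteq> 0" for w
    using L_nonconst[OF that, of 0] by simp
  \<comment> \<open>Agreement is claimed only off the zeros of \<open>q\<close>: with division by
    zero equal to 0, bringing a sum to a common denominator can fail at a zero of one
    denominator.\<close>
  have rational: "\<exists>p q. q \<noteq> 0 \<and> (\<forall>t\<in>{0..1}. poly q (of_real t) \<noteq> 0 \<longrightarrow>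
      f (\<gamma> t) = poly p (of_real t) / poly q (of_real t))" if "frac_form k f" for k f
    using that
  proof induction
    case (zero k)
    show ?case by (intro exI[of _ 0] exI[of _ 1]) simp
  next
    case (const a)
    show ?case by (intro exI[of _ "[:a:]"] exI[of _ 1]) simp
  next
    case (add k f g)
    then obtain p q p' q' where "q \<noteq> 0" "q' \<noteq> 0"
      "\<forall>t\<in>{0..1}. poly q (of_real t) \<noteq> 0 \<longrightarrow> f (\<gamma> t) = poly p (of_real t) / poly q (of_real t)"
      "\<forall>t\<in>{0..1}. poly q' (of_real t) \<noteq> 0 \<longrightarrow> g (\<gamma> t) = poly p' (of_real t) / poly q' (of_real t)"
      by blast
    then show ?case
      by (intro exI[of _ "p * q' + p' * q"] exI[of _ "q * q'"]) (auto simp: field_simps)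
  next
    case (cmult k f a)
    then obtain p q where "q \<noteq> 0"
      "\<forall>t\<in>{0..1}. poly q (of_real t) \<noteq> 0 \<longrightarrow> f (\<gamma> t) = poly p (of_real t) / poly q (of_real t)"
      by blast
    then show ?case
      by (intro exI[of _ "smult a p"] exI[of _ q]) auto
  next
    case (divide k f w)
    then obtain p q where "q \<noteq> 0"
      "\<forall>t\<in>{0..1}. poly q (of_real t) \<noteq> 0 \<longrightarrow> f (\<gamma> t) = poly p (of_real t) / poly q (of_real t)"
      by blast
    then show ?case
      using L_nz[OF divide(2)] L b
      by (intro exI[of _ "p * b"] exI[of _ "q * L w"]) auto
  qed
  obtain V W c where V: "finite V" "finite W" "0 \<notin> W" "\<And>v. v \<in> V \<Longrightarrow> frac_form CARD('n) (c v)"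
    and F: "\<And>z. (\<forall>w\<in>W. bilin z (cvec w) \<noteq> 0) \<Longrightarrow> fourier_laplace P z = (\<Sum>v\<in>V. c v z * wave z v)"
    using exp_form_fourier_laplace_polytopal_region[OF P] unfolding exp_form_def by blast
  obtain r s where rs: "\<And>v. v \<in> V \<Longrightarrow> s v \<noteq> 0"
    "\<And>v t. v \<in> V \<Longrightarrow> t \<in> {0..1} \<Longrightarrow> poly (s v) (of_real t) \<noteq> 0 \<Longrightarrow>
      c v (\<gamma> t) = poly (r v) (of_real t) / poly (s v) (of_real t)"
    using rational[OF V(4)] by metis
  \<comment> \<open>The zeros of \<open>Q\<close> include every bad parameter: those where some
    \<open>s v\<close> vanishes and those where the curve meets an exceptional hyperplane.\<close>
  define Q where "Q = (\<Prod>v\<in>V. s v) * (\<Prod>w\<in>W. L w)"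
  \<comment> \<open>This is \<open>Q^2 * c v\<close> along the curve. One factor \<open>Q\<close>
    clears the denominator \<open>s v\<close>; the other makes \<open>C v\<close> vanish at the bad
    parameters, so that the relation holds on the whole interval.\<close>
  define C where "C v = r v * (\<Prod>u\<in>V - {v}. s u) * (\<Prod>w\<in>W. L w) * Q" for v
  have "L w \<noteq> 0" if "w \<in> W" for w using L_nz V(3) that by metis
  then have Q0: "Q \<noteq> 0" using V(1,2) rs(1) by (auto simp: Q_def)
  have Q_s: "poly (s v) x \<noteq> 0" if "poly Q x \<noteq> 0" "v \<in> V" for v x
    using that V by (auto simp: Q_def poly_prod)
  have Q_W: "\<forall>w\<in>W. bilin (\<gamma> t) (cvec w) \<noteq> 0" if "poly Q (of_real t) \<noteq> 0" "t \<in> {0..1}" for t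
    using that V b by (auto simp: Q_def poly_prod L)
  have C: "poly (C v) (of_real t) = poly Q (of_real t)^2 * c v (\<gamma> t)"
    if "v \<in> V" "t \<in> {0..1}" "poly Q (of_real t) \<noteq> 0" for v t
  proof -
    have "Q = s v * ((\<Prod>u\<in>V - {v}. s u) * (\<Prod>w\<in>W. L w))"
      unfolding Q_def using V(1) that(1) by (simp add: prod.remove[of V v] mult.assoc)
    then have "C v * s v = r v * Q^2"
      by (simp add: C_def power2_eq_square algebra_simps)
    then have "poly (C v) (of_real t) * poly (s v) (of_real t) =
        poly (r v) (of_real t) * poly Q (of_real t)^2"
      by (metis poly_mult poly_power)
    also have "poly (r v) (of_real t) = c v (\<gamma> t) * poly (s v) (of_real t)"
      using rs(2)[OF that(1,2)] Q_s[OF that(3,1)] by simp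
    finally show ?thesis using Q_s[OF that(3,1)] by simp
  qed
  define A where "A v = smult (- 2 * complex_of_real pi * \<i>) (L v)" for v
  have wave_eq: "wave (\<gamma> t) v = exp (poly (A v) (of_real t) / poly b (of_real t))"
    if "t \<in> {0..1}" for v t
    using L[OF that] by (simp add: wave_def A_def)
  have "\<forall>v\<in>V. C v = 0"
  proof (rule exp_rational_linear_independent[OF V(1), of b A])
    show "poly b (of_real t) \<noteq> 0" if "t \<in> {0<..<1}" for t using b that by auto
    show "A v - A w \<noteq> smult k b" if "v \<noteq> w" for v w k
    proof
      let ?a = "- 2 * complex_of_real pi * \<i>"
      assume "A v - A w = smult k b"
      then have "smult ?a (L (v - w)) = smult k b"
        by (simp only: A_def L_diff[symmetric] smult_diff_right)
      then have "smult (1 / ?a) (smult ?a (L (v - w))) = smult (1 / ?a) (smult k b)"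
        by (rule arg_cong)
      then have "L (v - w) = smult (1 / ?a * k) b"
        unfolding smult_smult by simp
      moreover have "v - w \<noteq> 0" using that by simp
      ultimately show False using L_nonconst by blast
    qed
    show "(\<Sum>v\<in>V. poly (C v) (of_real t) * exp (poly (A v) (of_real t) / poly b (of_real t))) = 0"
      if "t \<in> {0<..<1}" for t
    proof (cases "poly Q (of_real t) = 0")
      case True
      then show ?thesis by (simp add: C_def)
    next
      case False
      have t: "t \<in> {0..1}" using that by auto
      have "(\<Sum>v\<in>V. poly (C v) (of_real t) * exp (poly (A v) (of_real t) / poly b (of_real t))) =
          poly Q (of_real t)^2 * (\<Sum>v\<in>V. c v (\<gamma> t) * wave (\<gamma> t) v)"
        using C[OF _ t False] wave_eq[OF t] by (simp add: sum_distrib_left mult.assoc)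
      also have "\<dots> = 0"
        using F[OF Q_W[OF False t]] vanish t by simp
      finally show ?thesis .
    qed
  qed
  moreover have "\<exists>t\<in>{0..1}. poly Q (complex_of_real t) \<noteq> 0"
  proof (rule ccontr)
    assume "\<not> ?thesis"
    then have "complex_of_real ` {0..1} \<subseteq> {x. poly Q x = 0}" by auto
    then have "finite (complex_of_real ` {0..1})"
      by (rule finite_subset) (rule poly_roots_finite[OF Q0])
    then show False by (simp add: finite_image_iff inj_on_def infinite_Icc)
  qed
  then obtain t where t: "t \<in> {0..1}" "poly Q (complex_of_real t) \<noteq> 0" by blast
  ultimately have c0: "c v (\<gamma> t) = 0" if "v \<in> V" for v
    using C[OF that t] that by simp
  have "fourier_laplace P (x *s \<gamma> t) = 0" if "x \<noteq> 0" for x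
  proof -
    have "c v (x *s \<gamma> t) = 0" if "v \<in> V" for v
      using frac_form_homogeneous[OF V(4)[OF that]] c0[OF that] by simp
    then show ?thesis
      using F[of "x *s \<gamma> t"] Q_W[OF t(2,1)] that by (simp add: bilin_scale_left)
  qed
  then have "fourier_laplace P 0 = 0"
    using fourier_laplace_scale_tendsto[OF compact_polytopal_region[OF P], of "\<gamma> t"]
    by (simp add: LIMSEQ_const_iff del: of_nat_Suc)
  then show False using fourier_laplace_0_polytopal_region[OF P] by simp
qed

theorem corollary3p2:
  fixes \<gamma> :: "real \<Rightarrow> complex ^ 'n" and P :: "(real ^ 'n) set"
  assumes "CARD('n) \<ge> 2"
    and "rational_curve \<gamma>"
    and "polytopal_region P"
  shows "((\<nexists>H :: (complex ^ 'n) set. affine_hyperplane H \<and> \<gamma> ` {0..1} \<subseteq> H)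
            \<longrightarrow> \<not> (\<forall>t\<in>{0..1}. fourier_laplace P (\<gamma> t) = 0)) \<and>
         (\<gamma> ` {0..1} \<subseteq> range cvec \<and>
            (\<nexists>H :: (real ^ 'n) set. affine_hyperplane H \<and> \<gamma> ` {0..1} \<subseteq> cvec ` H)
            \<longrightarrow> \<not> (\<forall>t\<in>{0..1}. fourier_laplace P (\<gamma> t) = 0))"
proof (intro conjI impI)
  assume H: "\<nexists>H :: (complex ^ 'n) set. affine_hyperplane H \<and> \<gamma> ` {0..1} \<subseteq> H"
  show "\<not> (\<forall>t\<in>{0..1}. fourier_laplace P (\<gamma> t) = 0)"
  proof (rule fourier_laplace_nonzero_on_rational_curve[OF assms(2,3)], rule notI)
    fix w :: "real ^ 'n" and k
    assume "w \<noteq> 0" and k: "\<forall>t\<in>{0..1}. bilin (\<gamma> t) (cvec w) = k"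
    then have "cvec w \<noteq> 0" by (auto simp: cvec_def vec_eq_iff)
    from affine_hyperplane_linear_equation[OF this, of k] H k show False
      by (auto simp: bilin_def)
  qed
next
  assume H: "\<gamma> ` {0..1} \<subseteq> range cvec \<and>
    (\<nexists>H :: (real ^ 'n) set. affine_hyperplane H \<and> \<gamma> ` {0..1} \<subseteq> cvec ` H)"
  show "\<not> (\<forall>t\<in>{0..1}. fourier_laplace P (\<gamma> t) = 0)"
  proof (rule fourier_laplace_nonzero_on_rational_curve[OF assms(2,3)], rule notI)
    fix w :: "real ^ 'n" and k
    assume w: "w \<noteq> 0" and k: "\<forall>t\<in>{0..1}. bilin (\<gamma> t) (cvec w) = k"
    \<comment> \<open>Both the curve and \<open>w\<close> are real here, so the constant value
      \<open>k\<close> is real and \<open>Re k\<close> is the level of a real hyperplane.\<close>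
    have "\<gamma> ` {0..1} \<subseteq> cvec ` {x. (\<Sum>i\<in>UNIV. x $ i * w $ i) = Re k}"
    proof
      fix y assume y: "y \<in> \<gamma> ` {0..1}"
      then obtain x where x: "y = cvec x" using H by blast
      then have "bilin (cvec x) (cvec w) = k" using y k by auto
      then have "(\<Sum>i\<in>UNIV. x $ i * w $ i) = Re k"
        by (auto simp: bilin_def cvec_def)
      then show "y \<in> cvec ` {x. (\<Sum>i\<in>UNIV. x $ i * w $ i) = Re k}" using x by blast
    qed
    with affine_hyperplane_linear_equation[OF w, of "Re k"] H show False by blast
  qed
qed

end
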